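(* Let $f$ be a transitive and expanding Lorenz map and let $\hat f$ be the map induced on $\mathbb{X}$. Then $\hat f$ is strongly transitive, that is, for every nonempty open set $U\subset\mathbb{X}$ there is $k$ such that $\bigcup_{i=0}^k\hat f^i(U)=\mathbb{X}$.
   Context: **Expanding Lorenz map.** A map $f\colon[0,1]\to[0,1]$ such that: (i) there is a critical point $c\in(0,1)$ such that $f$ is continuous and strictly increasing on $[0,c)$ and on $(c,1]$; (ii) $\lim_{x\to c^-}f(x)=1$ and $\lim_{x\to c^+}f(x)=0$; (iii) $f$ is differentiable outside a finite set $F\subseteq[0,1]$ and $\inf_{x\notin F}f'(x)>1$. The value $f(c)$ is taken to be $0$ or $1$ (either choice). **Doubled space.** Let $A=\left(\bigcup_{n\ge0}f^{-n}(c)\right)\setminus\{0,1\}$. The space $\mathbb{X}$ is obtained from $[0,1]$ by replacing each $a\in A$ by two points $a_-<a_+$, with the induced linear order and the order topology; it is a Cantor set. The continuous map $\hat f\colon\mathbb{X}\to\mathbb{X}$ is given by: $\hat f(c_-)=1$, $\hat f(c_+)=0$; $\hat f(a_\pm)=f(a)_\pm$ for $a\in A\setminus\{c\}$; $\hat f(x)=f(x)$ for $x\in[0,1]\setminus(A\cup\{0,1\})$; $\hat f(0)=f(0)_+$ if $f(0)\in A$ and $\hat f(0)=f(0)$ otherwise; $\hat f(1)=f(1)_-$ if $f(1)\in A$ and $\hat f(1)=f(1)$ otherwise. **Transitivity.** $f$ is transitive if $\hat f$ is topologically transitive: for every two nonempty open sets $U,V\subseteq\mathbb{X}$ there is an integer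 $n>0$ with $\hat f^n(U)\cap V\neq\emptyset$. *)

theory Defs
  imports "HOL-Analysis.Analysis"
begin

text \<open>
  A map of the unit interval is a function on the reals of which only the values on \<open>{0..1}\<close> matter;
  accordingly derivatives are taken within \<open>{0..1}\<close>, that is, one-sided at the end points.
  As \<open>f\<close> is increasing on both branches, its derivatives are nonnegative, so the infimum is
  over a nonempty set that is bounded below.
\<close>

definition expanding_lorenz_map :: "(real \<Rightarrow> real) \<Rightarrow> real \<Rightarrow> bool" where
  "expanding_lorenz_map f c \<longleftrightarrow>
     f \<in> {0..1} \<rightarrow> {0..1} \<and>
     0 < c \<and> c < 1 \<and>
     continuous_on {0..<c} f \<and> strict_mono_on {0..<c} f \<and>
     continuous_on {c<..1} f \<and> strict_mono_on {c<..1} f \<and>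
     (f \<longlongrightarrow> 1) (at_left c) \<and> (f \<longlongrightarrow> 0) (at_right c) \<and>
     f c \<in> {0, 1} \<and>
     (\<exists>F f'. finite F \<and> F \<subseteq> {0..1} \<and>
        (\<forall>x\<in>{0..1} - F. (f has_real_derivative f' x) (at x within {0..1})) \<and>
        (INF x\<in>{0..1} - F. f' x) > 1)"

definition doubled_points :: "(real \<Rightarrow> real) \<Rightarrow> real \<Rightarrow> real set" where
  "doubled_points f c = (\<Union>n. {x \<in> {0..1}. (f ^^ n) x = c}) - {0, 1}"

text \<open>
  \<open>Lower a\<close> and \<open>Upper a\<close> stand for the two copies \<open>a\<^sub>-\<close> and \<open>a\<^sub>+\<close> of a doubled point,
  \<open>Single x\<close> for a point that is not doubled.  The order is lexicographic.
\<close>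

datatype dpoint = Lower real | Single real | Upper real

primrec base_point :: "dpoint \<Rightarrow> real" where
  "base_point (Lower x) = x"
| "base_point (Single x) = x"
| "base_point (Upper x) = x"

primrec side :: "dpoint \<Rightarrow> int" where
  "side (Lower x) = -1"
| "side (Single x) = 0"
| "side (Upper x) = 1"

instantiation dpoint :: linorder
begin

definition less_dpoint :: "dpoint \<Rightarrow> dpoint \<Rightarrow> bool" where
  "p < q \<longleftrightarrow> base_point p < base_point q \<or> base_point p = base_point q \<and> side p < side q"

definition less_eq_dpoint :: "dpoint \<Rightarrow> dpoint \<Rightarrow> bool" where
  "p \<le> q \<longleftrightarrow> p < q \<or> p = (q :: dpoint)"

instance
proof
  fix p q r :: dpoint
  show "p < q \<longleftrightarrow> p \<le> q \<and> \<not> q \<le> p"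
    by (auto simp: less_dpoint_def less_eq_dpoint_def)
  show "p \<le> p"
    by (simp add: less_eq_dpoint_def)
  show "p \<le> q \<Longrightarrow> q \<le> r \<Longrightarrow> p \<le> r"
    by (auto simp: less_dpoint_def less_eq_dpoint_def)
  show "p \<le> q \<Longrightarrow> q \<le> p \<Longrightarrow> p = q"
    by (auto simp: less_dpoint_def less_eq_dpoint_def)
  show "p \<le> q \<or> q \<le> p"
    by (cases p; cases q) (auto simp: less_dpoint_def less_eq_dpoint_def)
qed

end

definition doubled_space :: "(real \<Rightarrow> real) \<Rightarrow> real \<Rightarrow> dpoint set" where
  "doubled_space f c =
     Single ` ({0..1} - doubled_points f c) \<union>
     Lower ` doubled_points f c \<union> Upper ` doubled_points f c"

definition order_topology_on :: "'a::linorder set \<Rightarrow> 'a topology" where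
  "order_topology_on X =
     topology_generated_by
       ({X} \<union> {{y \<in> X. y < x} | x. x \<in> X} \<union> {{y \<in> X. x < y} | x. x \<in> X})"

lemma topspace_order_topology_on [simp]: "topspace (order_topology_on X) = X"
  by (auto simp: order_topology_on_def)

definition doubled_topology :: "(real \<Rightarrow> real) \<Rightarrow> real \<Rightarrow> dpoint topology" where
  "doubled_topology f c = order_topology_on (doubled_space f c)"

lemma topspace_doubled_topology [simp]: "topspace (doubled_topology f c) = doubled_space f c"
  by (simp add: doubled_topology_def)

primrec doubled_map :: "(real \<Rightarrow> real) \<Rightarrow> real \<Rightarrow> dpoint \<Rightarrow> dpoint" where
  "doubled_map f c (Lower a) = (if a = c then Single 1 else Lower (f a))"
| "doubled_map f c (Upper a) = (if a = c then Single 0 else Upper (f a))"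
| "doubled_map f c (Single x) =
     (if x = 0 \<and> f 0 \<in> doubled_points f c then Upper (f 0)
      else if x = 1 \<and> f 1 \<in> doubled_points f c then Lower (f 1)
      else Single (f x))"

definition topologically_transitive :: "'a topology \<Rightarrow> ('a \<Rightarrow> 'a) \<Rightarrow> bool" where
  "topologically_transitive T g \<longleftrightarrow>
     (\<forall>U V. openin T U \<and> U \<noteq> {} \<and> openin T V \<and> V \<noteq> {} \<longrightarrow>
        (\<exists>n>0. (g ^^ n) ` U \<inter> V \<noteq> {}))"

definition strongly_transitive :: "'a topology \<Rightarrow> ('a \<Rightarrow> 'a) \<Rightarrow> bool" where
  "strongly_transitive T g \<longleftrightarrow>
     (\<forall>U. openin T U \<and> U \<noteq> {} \<longrightarrow> (\<exists>k. (\<Union>i\<in>{0..k}. (g ^^ i) ` U) = topspace T))"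

definition transitive_lorenz_map :: "(real \<Rightarrow> real) \<Rightarrow> real \<Rightarrow> bool" where
  "transitive_lorenz_map f c \<longleftrightarrow>
     topologically_transitive (doubled_topology f c) (doubled_map f c)"

lemma expanding_lorenz_map_less_1:
  assumes "expanding_lorenz_map f c" "0 \<le> x" "x < c"
  shows "f x < 1"
proof -
  obtain y where y: "x < y" "y < c"
    using dense assms(3) by blast
  then have "f x < f y"
    using assms y by (auto simp: expanding_lorenz_map_def strict_mono_on_def)
  also have "f y \<le> 1"
    using assms y by (auto simp: expanding_lorenz_map_def Pi_iff)
  finally show ?thesis .
qed

lemma expanding_lorenz_map_greater_0:
  assumes "expanding_lorenz_map f c" "c < x" "x \<le> 1"
  shows "0 < f x"
proof -
  obtain y where y: "c < y" "y < x"
    using dense assms(2) by blast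
  have "0 \<le> f y"
    using assms y by (auto simp: expanding_lorenz_map_def Pi_iff)
  also have "f y < f x"
    using assms y by (auto simp: expanding_lorenz_map_def strict_mono_on_def)
  finally show ?thesis .
qed

lemma expanding_lorenz_map_interior:
  assumes "expanding_lorenz_map f c" "0 < x" "x < 1" "x \<noteq> c"
  shows "0 < f x" "f x < 1"
proof -
  have sm: "strict_mono_on {0..<c} f" "strict_mono_on {c<..1} f"
    and r: "f 0 \<ge> 0" "f 1 \<le> 1"
    using assms by (auto simp: expanding_lorenz_map_def Pi_iff)
  show "0 < f x"
  proof (cases "x < c")
    case True
    then have "f 0 < f x"
      using sm(1) assms by (auto simp: strict_mono_on_def)
    then show ?thesis using r by simp
  qed (use expanding_lorenz_map_greater_0[OF assms(1), of x] assms in auto)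
  show "f x < 1"
  proof (cases "x < c")
    case False
    then have "f x < f 1"
      using sm(2) assms by (auto simp: strict_mono_on_def)
    then show ?thesis using r by simp
  qed (use expanding_lorenz_map_less_1[OF assms(1), of x] assms in auto)
qed

lemma doubled_points_image_iff:
  assumes "expanding_lorenz_map f c" "0 < x" "x < 1" "x \<noteq> c"
  shows "f x \<in> doubled_points f c \<longleftrightarrow> x \<in> doubled_points f c"
proof -
  have "(\<exists>n. (f ^^ n) (f x) = c) \<longleftrightarrow> (\<exists>n. (f ^^ n) x = c)"
  proof
    assume "\<exists>n. (f ^^ n) (f x) = c"
    then show "\<exists>n. (f ^^ n) x = c"
      by (metis funpow_Suc_right comp_apply)
  next
    assume "\<exists>n. (f ^^ n) x = c"
    then obtain n where n: "(f ^^ n) x = c" ..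
    with assms(4) obtain m where "n = Suc m" by (cases n) auto
    with n show "\<exists>n. (f ^^ n) (f x) = c"
      by (auto simp: funpow_Suc_right simp del: funpow.simps)
  qed
  then show ?thesis
    using expanding_lorenz_map_interior[OF assms] assms
    by (auto simp: doubled_points_def)
qed

lemma critical_point_doubled:
  "expanding_lorenz_map f c \<Longrightarrow> c \<in> doubled_points f c"
  by (auto simp: doubled_points_def expanding_lorenz_map_def intro: exI[of _ 0])

lemma doubled_map_in_doubled_space:
  assumes "expanding_lorenz_map f c" "p \<in> doubled_space f c"
  shows "doubled_map f c p \<in> doubled_space f c"
proof -
  have A: "0 < a \<and> a < 1" if "a \<in> doubled_points f c" for a
    using that by (force simp: doubled_points_def)
  have end_points: "0 \<notin> doubled_points f c" "1 \<notin> doubled_points f c"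
    by (auto simp: doubled_points_def)
  have range: "f x \<in> {0..1}" if "x \<in> {0..1}" for x
    using that assms(1) by (auto simp: expanding_lorenz_map_def Pi_iff)
  show ?thesis
  proof (cases p)
    case (Lower a)
    then have "a \<in> doubled_points f c"
      using assms(2) by (auto simp: doubled_space_def)
    then show ?thesis
      using Lower A end_points doubled_points_image_iff[OF assms(1), of a]
      by (auto simp: doubled_space_def)
  next
    case (Upper a)
    then have "a \<in> doubled_points f c"
      using assms(2) by (auto simp: doubled_space_def)
    then show ?thesis
      using Upper A end_points doubled_points_image_iff[OF assms(1), of a]
      by (auto simp: doubled_space_def)
  next
    case (Single x)
    then have x: "x \<in> {0..1}" "x \<notin> doubled_points f c"
      using assms(2) by (auto simp: doubled_space_def)
    then have "x \<noteq> c"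
      using critical_point_doubled[OF assms(1)] by auto
    consider "x = 0" | "x = 1" | "0 < x" "x < 1"
      using x(1) by fastforce
    then show ?thesis
    proof cases
      case 3
      then show ?thesis
        using Single x range[OF x(1)] doubled_points_image_iff[OF assms(1) 3 \<open>x \<noteq> c\<close>]
        by (auto simp: doubled_space_def)
    qed (use Single x range[OF x(1)] in \<open>auto simp: doubled_space_def\<close>)
  qed
qed

end

theory Submission
  imports Defs
begin

text \<open>
  Say that \<open>P x y\<close> holds if all points between \<open>x\<^sub>+\<close> and \<open>y\<^sub>-\<close> lie in finitely many iterates of \<open>U\<close>.
  This relation is transitive and is carried along by the map as long as the interval does not
  cross \<open>c\<close>, while the interval is stretched.  Hence some intervals \<open>[a, c]\<close> and \<open>[c, b]\<close> are covered.
  Follow the image of \<open>[c, b]\<close> until it first returns to the maximal covered interval \<open>D\<close> around \<open>c\<close>.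
  The return map sends \<open>D\<close> to the right of \<open>c\<close> into \<open>D\<close> and does not contract, so \<open>b\<close> can be chosen,
  arbitrarily close to the right end of \<open>D\<close>, such that the right end of the image does not exceed \<open>b\<close>;
  the same holds on the left.  The pieces of the two orbits then form an invariant
  finite union of closed covered intervals.  By transitivity it is the whole of \<open>[0, 1]\<close>, and
  gluing the finitely many pieces gives \<open>P 0 1\<close>.
\<close>

section \<open>Covering relations under an expanding pair of branches\<close>

text \<open>
  \<open>gL\<close> and \<open>gR\<close> are the two versions of a Lorenz map that are continuous from the left and from the right
  at \<open>c\<close>: the first acts on right end points of intervals, the second on left end points.
\<close>

locale expanding_pair =
  fixes c lam :: real and gL gR :: "real \<Rightarrow> real" and P :: "real \<Rightarrow> real \<Rightarrow> bool"
  assumes lam: "1 < lam"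
    and same: "x \<noteq> c \<Longrightarrow> gL x = gR x"
    and expand: "\<lbrakk>0 \<le> x; x < y; y \<le> 1; y \<le> c \<or> c \<le> x\<rbrakk> \<Longrightarrow> lam * (y - x) \<le> gL y - gR x"
    and dom: "P x y \<Longrightarrow> 0 \<le> x \<and> x < y \<and> y \<le> 1"
    and trans: "P x y \<Longrightarrow> P y z \<Longrightarrow> P x z"
    and sub: "\<lbrakk>P x y; x \<le> x'; x' < y'; y' \<le> y\<rbrakk> \<Longrightarrow> P x' y'"
    and step: "\<lbrakk>P x y; y \<le> c \<or> c \<le> x\<rbrakk> \<Longrightarrow> P (gR x) (gL y)"
begin

text \<open>The reflection \<open>1 - x\<close> exchanges left and right end points, hence
  \<open>gL\<close> and \<open>gR\<close>; results about the right side of \<open>c\<close> thus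
  transfer to the left side.\<close>

lemma mirror:
  "expanding_pair (1 - c) lam (\<lambda>x. 1 - gR (1 - x)) (\<lambda>x. 1 - gL (1 - x)) (\<lambda>x y. P (1 - y) (1 - x))"
proof (unfold_locales, goal_cases)
  case (3 x y)
  then show ?case
    using expand[of "1 - y" "1 - x"] by auto
next
  case (4 x y)
  then show ?case
    using dom[of "1 - y" "1 - x"] by auto
next
  case (7 x y)
  then have "P (gR (1 - y)) (gL (1 - x))"
    by (intro step) auto
  then show ?case
    by simp
qed (use lam in \<open>auto intro: trans sub simp: same\<close>)

lemma same_side:
  assumes "0 \<le> u" "u < v" "v \<le> 1" "v \<le> c \<or> c < u"
  shows "v - u \<le> gL v - gL u"
proof -
  have "1 * (v - u) \<le> lam * (v - u)"
    using lam assms by (intro mult_right_mono) auto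
  also have "\<dots> \<le> gL v - gL u"
    using expand[of u v] same[of u] assms by auto
  finally show ?thesis
    by simp
qed

lemma gR_mono: "\<lbrakk>0 \<le> x; x \<le> y; y \<le> 1; y < c \<or> c \<le> x\<rbrakk> \<Longrightarrow> gR x \<le> gR y"
proof (cases "x = y")
  case False
  assume a: "0 \<le> x" "x \<le> y" "y \<le> 1" "y < c \<or> c \<le> x"
  have "0 \<le> lam * (y - x)"
    using lam a by simp
  then show ?thesis
    using expand[of x y] same[of y] a False by auto
qed auto

lemma gL_mono: "\<lbrakk>0 \<le> x; x \<le> y; y \<le> 1; y \<le> c \<or> c < x\<rbrakk> \<Longrightarrow> gL x \<le> gL y"
  using same_side[of x y] by (cases "x = y") auto

text \<open>As long as no earlier image has \<open>c\<close> in its interior, \<open>step\<close>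
  keeps the image covered and \<open>expand\<close> multiplies the lower bound on its length by
  \<open>lam\<close>.\<close>

lemma iterate:
  assumes "P x y" and "\<And>j. j < i \<Longrightarrow> (gL ^^ j) y \<le> c \<or> c \<le> (gR ^^ j) x"
  shows "P ((gR ^^ i) x) ((gL ^^ i) y) \<and> lam ^ i * (y - x) \<le> (gL ^^ i) y - (gR ^^ i) x"
  using assms(2)
proof (induction i)
  case (Suc i)
  let ?x = "(gR ^^ i) x" and ?y = "(gL ^^ i) y"
  have IH: "P ?x ?y" "lam ^ i * (y - x) \<le> ?y - ?x" and nc: "?y \<le> c \<or> c \<le> ?x"
    using Suc by auto
  have "lam * (lam ^ i * (y - x)) \<le> lam * (?y - ?x)"
    using IH lam by (intro mult_left_mono) auto
  also have "\<dots> \<le> gL ?y - gR ?x"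
    using expand dom[OF IH(1)] nc by blast
  finally show ?case
    using step[OF IH(1) nc] by (simp add: mult.assoc)
qed (use assms in auto)

text \<open>Otherwise the lengths would grow geometrically by \<open>iterate\<close>, although
  \<open>dom\<close> bounds them by 1.\<close>

lemma crossing_time:
  assumes "P x y"
  shows "\<exists>j. (gR ^^ j) x < c \<and> c < (gL ^^ j) y"
proof (rule ccontr)
  assume "\<not> ?thesis"
  then have *: "(gL ^^ j) y \<le> c \<or> c \<le> (gR ^^ j) x" for j
    by (meson not_less)
  have "lam ^ i * (y - x) \<le> 1" for i
    using iterate[OF assms *, of i] dom[of "(gR ^^ i) x" "(gL ^^ i) y"] by force
  moreover obtain i where "1 / (y - x) < lam ^ i"
    using real_arch_pow[OF lam] by blast
  then have "1 < lam ^ i * (y - x)"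
    using dom[OF assms] by (simp add: field_simps)
  ultimately show False
    by (meson not_less)
qed

text \<open>Up to the first crossing time \<open>iterate\<close> applies, so the crossing image is
  covered, and \<open>sub\<close> cuts it at \<open>c\<close>.\<close>

lemma crossing:
  assumes "P x y"
  shows "\<exists>a b. P a c \<and> P c b"
proof -
  define j where "j = (LEAST j. (gR ^^ j) x < c \<and> c < (gL ^^ j) y)"
  have j: "(gR ^^ j) x < c \<and> c < (gL ^^ j) y"
    unfolding j_def using crossing_time[OF assms] by (rule LeastI_ex)
  have "P ((gR ^^ j) x) ((gL ^^ j) y)"
    using iterate[OF assms, of j] not_less_Least[of _ "\<lambda>j. (gR ^^ j) x < c \<and> c < (gL ^^ j) y"]
    unfolding j_def[symmetric] by (meson not_less)
  then show ?thesis
    using j sub by (meson order.refl less_imp_le)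
qed

section \<open>The class of \<open>c\<close> and the first return to it\<close>

text \<open>The class \<open>D\<close> of \<open>c\<close> under the equivalence relation generated by \<open>P\<close>.\<close>

definition linked :: "real \<Rightarrow> bool" where
  "linked x \<longleftrightarrow> x = c \<or> P x c \<or> P c x"

text \<open>Restriction or concatenation at \<open>c\<close> relates \<open>y\<close> to
  \<open>c\<close>. Thus a covered piece whose left end has returned to \<open>D\<close> has its
  right end there too.\<close>

lemma linked_mono:
  assumes "linked x" "P x y"
  shows "linked y"
proof -
  consider "x = c" | "P x c" "y < c" | "y = c" | "P x c" "c < y" | "P c x"
    using assms(1) unfolding linked_def by fastforce
  then show ?thesis
    using sub[OF assms(2), of y c] trans[OF _ assms(2)] sub[OF assms(2), of c y] sub[of x c y c]
      dom[OF assms(2)] dom[of x c] assms(2)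
    unfolding linked_def by cases auto
qed

lemma linkedI: "P x y \<Longrightarrow> x \<le> c \<Longrightarrow> c \<le> y \<Longrightarrow> linked x"
  unfolding linked_def using sub[of x y x c] by force

text \<open>\<open>n\<close> is the first time the orbit of \<open>c\<close> under \<open>gR\<close>
  enters \<open>D\<close>. It is fixed before \<open>y\<close>, so that \<open>y\<close> may later
  depend on the return on the other side. The last clause keeps \<open>c\<close> out of the closed
  intermediate pieces, where \<open>gL\<close> and \<open>gR\<close> therefore agree.\<close>

lemma return:
  assumes "P c b0"
  shows "\<exists>n\<ge>1. linked ((gR ^^ n) c) \<and>
    (\<forall>y. linked y \<longrightarrow> (\<exists>b. P c b \<and> y \<le> b \<and> (gL ^^ n) b \<le> b \<and>
       (\<forall>i\<le>n. P ((gR ^^ i) c) ((gL ^^ i) b)) \<and>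
       (\<forall>i. 1 \<le> i \<and> i < n \<longrightarrow> (gL ^^ i) b < c \<or> c < (gR ^^ i) c)))"
proof -
  let ?x = "\<lambda>i. (gR ^^ i) c"
  have free: "(gL ^^ i) b < c \<or> c < ?x i"
    if "P (?x i) ((gL ^^ i) b)" "\<not> linked (?x i)" for i b
    using linkedI that by (meson not_less)
  \<comment> \<open>At time 0 the left end is \<open>c\<close> itself, so nothing crosses
    \<open>c\<close>; at later times \<open>free\<close> excludes a crossing.\<close>
  have orbit: "P (?x i) ((gL ^^ i) b)"
    if "P c b" "\<And>j. 1 \<le> j \<Longrightarrow> j < i \<Longrightarrow> \<not> linked (?x j)" for i b
    using that(2)
  proof (induction i)
    case (Suc i)
    then have "P (?x i) ((gL ^^ i) b)" by auto
    moreover have "(gL ^^ i) b \<le> c \<or> c \<le> ?x i"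
      using free[OF calculation] Suc.prems[of i] by (cases i) auto
    ultimately show ?case
      using step by simp
  qed (use that in auto)
  \<comment> \<open>Without a return all pieces would be covered, and the crossing forced by
    expansion would link a left end.\<close>
  have "\<exists>n. 1 \<le> n \<and> linked (?x n)"
  proof (rule ccontr)
    assume none: "\<not> ?thesis"
    obtain j where j: "?x j < c" "c < (gL ^^ j) b0"
      using crossing_time[OF assms] by blast
    then have "linked (?x j)"
      using linkedI[OF orbit[OF assms, of j]] none by force
    then show False
      using none j by (cases j) auto
  qed
  then obtain n where n: "1 \<le> n" "linked (?x n)"
    and least: "\<And>j. 1 \<le> j \<Longrightarrow> j < n \<Longrightarrow> \<not> linked (?x j)"
    using exists_least_iff[of "\<lambda>n. 1 \<le> n \<and> linked (?x n)"] by blast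
  have orb: "P (?x i) ((gL ^^ i) b)" if "P c b" "i \<le> n" for i b
    using orbit[OF that(1)] least that(2) by auto
  have end_linked: "linked ((gL ^^ n) b)" if "P c b" for b
    using linked_mono[OF n(2) orb[OF that]] by simp
  \<comment> \<open>Both pieces have the same left end and do not cross \<open>c\<close>, so their
    right ends lie on one side of \<open>c\<close> and \<open>same_side\<close> applies at every
    step.\<close>
  have gap: "b' - b \<le> (gL ^^ i) b' - (gL ^^ i) b" if "P c b" "P c b'" "b < b'" "i \<le> n" for b b' i
    using that(4)
  proof (induction i)
    case (Suc i)
    let ?b = "(gL ^^ i) b" and ?b' = "(gL ^^ i) b'"
    have IH: "b' - b \<le> ?b' - ?b" and P: "P (?x i) ?b" "P (?x i) ?b'"
      using Suc orb that by auto
    have "?b' \<le> c \<or> c \<le> ?x i"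
      using free[OF P(2)] least[of i] Suc.prems by (cases i) auto
    then have "?b' - ?b \<le> gL ?b' - gL ?b"
      using dom[OF P(1)] dom[OF P(2)] IH that by (intro same_side) auto
    then show ?case
      using IH by simp
  qed auto
  have "\<exists>b. P c b \<and> y \<le> b \<and> (gL ^^ n) b \<le> b" if y: "linked y" for y
  proof -
    \<comment> \<open>\<open>d\<close> is the right end of \<open>D\<close>. If \<open>P c d\<close>
      holds, \<open>b = d\<close> works because linked points never exceed \<open>d\<close>;
      otherwise any point between \<open>max y c\<close> and \<open>d\<close> works, and the
      midpoint is taken.\<close>
    define d where "d = Sup {b. P c b}"
    have bdd: "bdd_above {b. P c b}"
      using dom by (intro bdd_aboveI[of _ 1]) auto
    have le_d: "b \<le> d" if "P c b" for b
      unfolding d_def using that bdd by (intro cSup_upper) auto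
    have "c < d"
      using le_d[OF assms] dom[OF assms] by auto
    have linked_le: "z \<le> d" if "linked z" for z
      using that le_d dom[of z c] \<open>c < d\<close> unfolding linked_def by force
    show ?thesis
    proof (cases "P c d")
      case True
      then show ?thesis
        using linked_le[OF y] linked_le[OF end_linked[OF True]] by blast
    next
      case False
      then have "y < d"
        using linked_le[OF y] y \<open>c < d\<close> dom[of y c] unfolding linked_def by (cases "y = d") auto
      have below: "P c z" if z: "c < z" "z < d" for z
      proof -
        obtain b where "P c b" "z < b"
          using less_cSup_iff[of "{b. P c b}" z] bdd assms z unfolding d_def by blast
        then show ?thesis
          using sub z by force
      qed
      define b where "b = (max y c + d) / 2"
      have b: "c < b" "y \<le> b" "b < d"
        using \<open>c < d\<close> \<open>y < d\<close> by (auto simp: b_def max_def)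
      \<comment> \<open>If the image exceeded \<open>b\<close> by some amount, a point
        \<open>z\<close> closer to \<open>d\<close> than that amount would by \<open>gap\<close> be
        sent beyond \<open>d\<close>, although its image is linked.\<close>
      have "(gL ^^ n) b \<le> b"
      proof (rule ccontr)
        assume "\<not> ?thesis"
        then have "max b (d - ((gL ^^ n) b - b)) < d"
          using b by auto
        then obtain z where z: "b < z" "d - ((gL ^^ n) b - b) < z" "z < d"
          using dense by (metis max_less_iff_conj)
        have "z - b \<le> (gL ^^ n) z - (gL ^^ n) b"
          using gap[of b z n] below b z by auto
        moreover have "(gL ^^ n) z \<le> d"
          using linked_le end_linked below b z by auto
        ultimately show False
          using z by linarith
      qed
      then show ?thesis
        using b below by blast
    qed
  qed
  moreover have "(gL ^^ i) b < c \<or> c < ?x i" if "P c b" "1 \<le> i" "i < n" for i b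
    using free[OF orb] least that by auto
  ultimately show ?thesis
    using n orb by (intro exI[of _ n]) blast
qed

section \<open>Gluing an invariant finite union of intervals\<close>

text \<open>Take the largest right end \<open>m\<close> reachable from 0 and, if
  \<open>m < 1\<close>, a point before the next left end \<open>M\<close>. The interval covering it
  starts at or before \<open>m\<close> and so extends the chain.\<close>

lemma finite_chain:
  assumes fin: "finite I" and I: "\<And>u v. (u, v) \<in> I \<Longrightarrow> P u v"
    and cover: "(\<Union>(u, v)\<in>I. {u..v}) = {0..1}"
  shows "P 0 1"
proof -
  define S where "S = {v \<in> snd ` I. P 0 v}"
  have "0 \<in> (\<Union>(u, v)\<in>I. {u..v})"
    unfolding cover by simp
  then obtain u v where uv: "(u, v) \<in> I" "u \<le> 0"
    by auto
  then have "P 0 v"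
    using I[OF uv(1)] dom[of u v] by auto
  then have S: "finite S" "S \<noteq> {}"
    using fin uv by (force simp: S_def)+
  define m where "m = Max S"
  have m: "P 0 m"
    using Max_in[OF S] by (simp add: m_def S_def)
  have "m = 1"
  proof (rule ccontr)
    assume "m \<noteq> 1"
    then have "m < 1"
      using dom[OF m] by simp
    define M where "M = Min (insert 1 {u \<in> fst ` I. m < u})"
    have "m < M"
      unfolding M_def using fin \<open>m < 1\<close> by (subst Min_gr_iff) auto
    then obtain t where t: "m < t" "t < M"
      using dense by blast
    have "M \<le> 1"
      unfolding M_def using fin by (intro Min_le) auto
    then have "t \<in> (\<Union>(u, v)\<in>I. {u..v})"
      unfolding cover using t dom[OF m] by auto
    then obtain u v where uv: "(u, v) \<in> I" "u \<le> t" "t \<le> v"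
      by auto
    have "u \<le> m"
    proof (rule ccontr)
      assume "\<not> u \<le> m"
      then have "M \<le> u"
        unfolding M_def using fin uv by (intro Min_le) force+
      then show False
        using uv t by simp
    qed
    then have "P m v"
      using sub[OF I[OF uv(1)], of m v] uv t by auto
    then have "v \<in> S"
      using trans[OF m] uv by (force simp: S_def)
    then have "v \<le> m"
      unfolding m_def using S by auto
    then show False
      using uv t by simp
  qed
  then show ?thesis
    using m by simp
qed

text \<open>\<open>invariant\<close> is the form in which transitivity enters. It is applied to the
  union \<open>T\<close> of \<open>[a, b]\<close> and the orbit pieces of \<open>[c, b]\<close> and
  \<open>[a, c]\<close> before their returns.\<close>

lemma full_interval:
  assumes "P x0 y0"
    and invariant: "\<And>T a b. \<lbrakk>closed T; T \<subseteq> {0..1}; a < b; {a..b} \<subseteq> T; gL ` T \<subseteq> T; gR ` T \<subseteq> T\<rbrakk> \<Longrightarrow> T = {0..1}"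
  shows "P 0 1"
proof -
  obtain a0 b0 where ab0: "P a0 c" "P c b0"
    using crossing[OF assms(1)] by blast
  interpret m: expanding_pair "1 - c" lam "\<lambda>x. 1 - gR (1 - x)" "\<lambda>x. 1 - gL (1 - x)" "\<lambda>x y. P (1 - y) (1 - x)"
    by (rule mirror)
  have pow: "((\<lambda>x. 1 - g (1 - x)) ^^ i) x = 1 - (g ^^ i) (1 - x)" for g :: "real \<Rightarrow> real" and i x
    by (induction i) auto
  have m_linked: "m.linked x \<longleftrightarrow> linked (1 - x)" for x
    by (auto simp: m.linked_def linked_def)
  obtain n where n: "1 \<le> n" "linked ((gR ^^ n) c)"
    and right: "\<And>y. linked y \<Longrightarrow> \<exists>b. P c b \<and> y \<le> b \<and> (gL ^^ n) b \<le> b \<and>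
       (\<forall>i\<le>n. P ((gR ^^ i) c) ((gL ^^ i) b)) \<and>
       (\<forall>i. 1 \<le> i \<and> i < n \<longrightarrow> (gL ^^ i) b < c \<or> c < (gR ^^ i) c)"
    using return[OF ab0(2)] by blast
  obtain k where k: "1 \<le> k" "linked ((gL ^^ k) c)"
    and left': "\<And>y. linked (1 - y) \<Longrightarrow> \<exists>b. P (1 - b) c \<and> y \<le> b \<and> 1 - (gR ^^ k) (1 - b) \<le> b \<and>
       (\<forall>i\<le>k. P ((gR ^^ i) (1 - b)) ((gL ^^ i) c)) \<and>
       (\<forall>i. 1 \<le> i \<and> i < k \<longrightarrow> 1 - (gR ^^ i) (1 - b) < 1 - c \<or> 1 - c < 1 - (gL ^^ i) c)"
    using m.return[of "1 - a0"] ab0(1) unfolding pow m_linked by auto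
  \<comment> \<open>Both return times are fixed and both returning ends are linked. So
    \<open>b\<close> can be chosen not below \<open>(gL ^^ k) c\<close>, then \<open>a\<close> not
    above \<open>(gR ^^ n) c\<close>, and both returned pieces fit into
    \<open>[a, b]\<close>.\<close>
  obtain b where b: "P c b" "(gL ^^ k) c \<le> b" "(gL ^^ n) b \<le> b"
    and bi: "\<And>i. i \<le> n \<Longrightarrow> P ((gR ^^ i) c) ((gL ^^ i) b)"
      "\<And>i. 1 \<le> i \<Longrightarrow> i < n \<Longrightarrow> (gL ^^ i) b < c \<or> c < (gR ^^ i) c"
    using right[OF k(2)] by blast
  obtain b' where b': "P (1 - b') c" "1 - (gR ^^ n) c \<le> b'" "1 - (gR ^^ k) (1 - b') \<le> b'"
     "\<And>i. i \<le> k \<Longrightarrow> P ((gR ^^ i) (1 - b')) ((gL ^^ i) c)"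
     "\<And>i. 1 \<le> i \<Longrightarrow> i < k \<Longrightarrow> 1 - (gR ^^ i) (1 - b') < 1 - c \<or> 1 - c < 1 - (gL ^^ i) c"
    using left'[of "1 - (gR ^^ n) c"] n(2) by auto
  define a where "a = 1 - b'"
  have a: "P a c" "a \<le> (gR ^^ n) c" "a \<le> (gR ^^ k) a"
    and ai: "\<And>i. i \<le> k \<Longrightarrow> P ((gR ^^ i) a) ((gL ^^ i) c)"
      "\<And>i. 1 \<le> i \<Longrightarrow> i < k \<Longrightarrow> (gL ^^ i) c < c \<or> c < (gR ^^ i) a"
    using b' by (auto simp: a_def)
  \<comment> \<open>Times 0, \<open>n\<close> and \<open>k\<close> are absent: the initial pieces
    are merged into \<open>[a, b]\<close>, which also contains the returned pieces.\<close>
  define I where "I = insert (a, b) ((\<lambda>i. ((gR ^^ i) c, (gL ^^ i) b)) ` {1..<n} \<union>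
     (\<lambda>i. ((gR ^^ i) a, (gL ^^ i) c)) ` {1..<k})"
  define T where "T = (\<Union>(u, v)\<in>I. {u..v})"
  have I: "P u v" if "(u, v) \<in> I" for u v
    using that trans[OF a(1) b(1)] bi(1) ai(1) by (auto simp: I_def)
  have ab: "0 \<le> a" "a < c" "c < b" "b \<le> 1"
    using dom[OF a(1)] dom[OF b(1)] by auto
  have R: "t \<in> T" if "1 \<le> i" "i \<le> n" "(gR ^^ i) c \<le> t" "t \<le> (gL ^^ i) b" for i t
    using that a b by (cases "i = n") (force simp: T_def I_def)+
  have L: "t \<in> T" if "1 \<le> i" "i \<le> k" "(gR ^^ i) a \<le> t" "t \<le> (gL ^^ i) c" for i t
    using that a b by (cases "i = k") (force simp: T_def I_def)+
  have main: "gR t \<in> T" if t: "c \<le> t" "t \<le> b" for t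
  proof -
    have "gR t \<le> gR b"
      using gR_mono[of t b] t ab by auto
    then show ?thesis
      using R[of 1 "gR t"] gR_mono[of c t] same[of b] n t ab by auto
  qed
  have main': "gL t \<in> T" if t: "a \<le> t" "t \<le> c" for t
  proof -
    have "gL a \<le> gL t"
      using gL_mono[of a t] t ab by auto
    then show ?thesis
      using L[of 1 "gL t"] gL_mono[of t c] same[of a] k t ab by auto
  qed
  \<comment> \<open>The piece misses \<open>c\<close>, so both maps agree and increase on it and
    send it into the next piece of its orbit, or into \<open>[a, b]\<close> at the return
    time.\<close>
  have side: "gR t \<in> T \<and> gL t \<in> T" if uv: "(u, v) \<in> I" "(u, v) \<noteq> (a, b)" and t: "u \<le> t" "t \<le> v" for u v t
  proof -
    consider i where "1 \<le> i" "i < n" "u = (gR ^^ i) c" "v = (gL ^^ i) b"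
      | i where "1 \<le> i" "i < k" "u = (gR ^^ i) a" "v = (gL ^^ i) c"
      using uv by (auto simp: I_def)
    note pieces = this
    have "v < c \<or> c < u"
      using bi(2) ai(2) by (cases rule: pieces) simp_all
    moreover have uv': "0 \<le> u" "v \<le> 1"
      using dom[OF I[OF uv(1)]] by auto
    ultimately have g: "gR u \<le> gR t" "gR t \<le> gL v" "gL t = gR t"
      using gR_mono[of u t] gR_mono[of t v] same[of t] same[of v] t by auto
    have "gR t \<in> T"
    proof (cases rule: pieces)
      case (1 i)
      then show ?thesis
        using R[of "Suc i" "gR t"] g by auto
    next
      case (2 i)
      then show ?thesis
        using L[of "Suc i" "gR t"] g by auto
    qed
    then show ?thesis
      using g by simp
  qed
  have "gR t \<in> T \<and> gL t \<in> T" if t: "t \<in> T" for t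
  proof -
    obtain u v where uv: "(u, v) \<in> I" "u \<le> t" "t \<le> v"
      using t by (auto simp: T_def)
    show ?thesis
    proof (cases "(u, v) = (a, b)")
      case True
      consider "t < c" | "t = c" | "c < t"
        by linarith
      then show ?thesis
        using uv True main[of t] main'[of t] same[of t] ab by cases auto
    qed (use side uv in blast)
  qed
  moreover have "closed T"
    unfolding T_def by (intro closed_UN) (auto simp: I_def)
  moreover have "T \<subseteq> {0..1}"
    using dom[OF I] by (force simp: T_def)
  moreover have "{a..b} \<subseteq> T" "a < b"
    using ab by (auto simp: T_def I_def)
  ultimately have "T = {0..1}"
    by (intro invariant) auto
  then show ?thesis
    using finite_chain[of I] I by (auto simp: T_def I_def)
qed

end

text \<open>Integrating the derivative tolerates finitely many exceptional points; the value
  \<open>m\<close> given to \<open>h'\<close> there keeps \<open>m\<close> a lower bound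
  everywhere.\<close>

lemma slope_ge:
  fixes h :: "real \<Rightarrow> real"
  assumes "finite S" "a \<le> b" "continuous_on {a..b} h"
    and deriv: "\<And>x. x \<in> {a<..<b} - S \<Longrightarrow> \<exists>D\<ge>m. (h has_real_derivative D) (at x)"
  shows "m * (b - a) \<le> h b - h a"
proof -
  obtain D where D: "D x \<ge> m" "(h has_real_derivative D x) (at x)" if "x \<in> {a<..<b} - S" for x
    using deriv by metis
  define h' where "h' x = (if x \<in> {a<..<b} - S then D x else m)" for x
  have "(h' has_integral (h b - h a)) {a..b}"
    using assms D(2) by (intro fundamental_theorem_of_calculus_interior_strong[of S])
      (auto simp: h'_def simp flip: has_real_derivative_iff_has_vector_derivative)
  moreover have "((\<lambda>x. m) has_integral (m * (b - a))) {a..b}"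
    using has_integral_const_real[of m a b] assms(2) by (simp add: mult.commute)
  ultimately show ?thesis
    using D(1) by (elim has_integral_le[rotated]) (auto simp: h'_def)
qed

section \<open>Lorenz maps: branches, doubled points and expansion\<close>

locale lorenz =
  fixes f :: "real \<Rightarrow> real" and c :: real
  assumes lorenz: "expanding_lorenz_map f c"
begin

abbreviation "A \<equiv> doubled_points f c"
abbreviation "X \<equiv> doubled_space f c"
abbreviation "fhat \<equiv> doubled_map f c"

text \<open>Whatever \<open>f c\<close> is, the left limit here and the right limit in
  \<open>gR\<close> extend the two branches continuously to \<open>c\<close>.\<close>

definition gL :: "real \<Rightarrow> real" where "gL = f(c := 1)"
definition gR :: "real \<Rightarrow> real" where "gR = f(c := 0)"

text \<open>\<open>up x\<close> and \<open>down x\<close> are \<open>x\<^sub>+\<close> and \<open>x\<^sub>-\<close>, which coincide if \<open>x\<close> is not doubled.\<close>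

definition up :: "real \<Rightarrow> dpoint" where "up x = (if x \<in> A then Upper x else Single x)"
definition down :: "real \<Rightarrow> dpoint" where "down x = (if x \<in> A then Lower x else Single x)"

lemma c_bounds: "0 < c" "c < 1"
  using lorenz by (auto simp: expanding_lorenz_map_def)

lemma f_range: "0 \<le> x \<Longrightarrow> x \<le> 1 \<Longrightarrow> 0 \<le> f x \<and> f x \<le> 1"
  using lorenz by (auto simp: expanding_lorenz_map_def Pi_iff)

lemma A_bounds: "x \<in> A \<Longrightarrow> 0 < x \<and> x < 1"
  by (force simp: doubled_points_def)

lemma end_points: "0 \<notin> A" "1 \<notin> A"
  by (auto simp: doubled_points_def)

lemma c_in_A: "c \<in> A"
  using critical_point_doubled[OF lorenz] .

lemma X_iff: "p \<in> X \<longleftrightarrow> 0 \<le> base_point p \<and> base_point p \<le> 1 \<and> (p = up (base_point p) \<or> p = down (base_point p))"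
  using A_bounds by (cases p) (force simp: doubled_space_def up_def down_def)+

lemma base_up [simp]: "base_point (up x) = x" and base_down [simp]: "base_point (down x) = x"
  by (auto simp: up_def down_def)

lemma up_in_X: "0 \<le> x \<Longrightarrow> x \<le> 1 \<Longrightarrow> up x \<in> X" and down_in_X: "0 \<le> x \<Longrightarrow> x \<le> 1 \<Longrightarrow> down x \<in> X"
  by (auto simp: X_iff)

text \<open>In \<open>X\<close>, \<open>up x\<close> is the largest and \<open>down x\<close> the
  smallest point with base point \<open>x\<close>, so comparisons reduce to base points.\<close>

lemma up_less_iff: "p \<in> X \<Longrightarrow> up x < p \<longleftrightarrow> x < base_point p"
  by (cases p) (auto simp: less_dpoint_def X_iff up_def down_def)

lemma less_down_iff: "p \<in> X \<Longrightarrow> p < down x \<longleftrightarrow> base_point p < x"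
  by (cases p) (auto simp: less_dpoint_def X_iff up_def down_def)

lemma continuous_gL: "continuous_on {0..c} gL"
proof -
  have f: "continuous_on {0..<c} f" "(f \<longlongrightarrow> 1) (at_left c)"
    using lorenz by (auto simp: expanding_lorenz_map_def)
  have g: "continuous_on {0..<c} gL"
    by (rule continuous_on_eq[OF f(1)]) (auto simp: gL_def)
  show ?thesis
  proof (rule continuous_on_IccI)
    have "continuous_on {0..c/2} gL"
      using c_bounds by (intro continuous_on_subset[OF g]) auto
    then show "(gL \<longlongrightarrow> gL 0) (at_right 0)"
      using c_bounds by (intro continuous_on_Icc_at_rightD[of 0 "c/2"]) auto
    have "eventually (\<lambda>x. f x = gL x) (at_left c)"
      by (auto simp: eventually_at_filter gL_def)
    then show "(gL \<longlongrightarrow> gL c) (at_left c)"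
      using f(2) by (simp add: gL_def Lim_transform_eventually)
    show "gL \<midarrow>x\<rightarrow> gL x" if "0 < x" "x < c" for x
    proof -
      have "continuous_on {0<..<c} gL"
        by (rule continuous_on_subset[OF g]) auto
      then show ?thesis
        using that continuous_on_eq_continuous_at[of "{0<..<c}" gL] by (auto simp: isCont_def)
    qed
  qed (use c_bounds in auto)
qed

lemma continuous_gR: "continuous_on {c..1} gR"
proof -
  have f: "continuous_on {c<..1} f" "(f \<longlongrightarrow> 0) (at_right c)"
    using lorenz by (auto simp: expanding_lorenz_map_def)
  have g: "continuous_on {c<..1} gR"
    by (rule continuous_on_eq[OF f(1)]) (auto simp: gR_def)
  show ?thesis
  proof (rule continuous_on_IccI)
    have "continuous_on {(c+1)/2..1} gR"
      using c_bounds by (intro continuous_on_subset[OF g]) auto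
    then show "(gR \<longlongrightarrow> gR 1) (at_left 1)"
      using c_bounds by (intro continuous_on_Icc_at_leftD[of "(c+1)/2" 1]) auto
    have "eventually (\<lambda>x. f x = gR x) (at_right c)"
      by (auto simp: eventually_at_filter gR_def)
    then show "(gR \<longlongrightarrow> gR c) (at_right c)"
      using f(2) by (simp add: gR_def Lim_transform_eventually)
    show "gR \<midarrow>x\<rightarrow> gR x" if "c < x" "x < 1" for x
    proof -
      have "continuous_on {c<..<1} gR"
        by (rule continuous_on_subset[OF g]) auto
      then show ?thesis
        using that continuous_on_eq_continuous_at[of "{c<..<1}" gR] by (auto simp: isCont_def)
    qed
  qed (use c_bounds in auto)
qed

text \<open>The infimum in the definition serves as \<open>m\<close>. The end points are dropped to
  get two-sided derivatives; \<open>c\<close> joins the exceptional set because \<open>gL\<close>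
  and \<open>gR\<close> can differ from \<open>f\<close> only there.\<close>

lemma derivative_bound:
  "\<exists>m>1. \<exists>S. finite S \<and> c \<in> S \<and> (\<forall>x\<in>{0<..<1} - S. \<exists>D\<ge>m. (f has_real_derivative D) (at x))"
proof -
  obtain F f' where F: "finite F"
    and f': "\<forall>x\<in>{0..1} - F. (f has_real_derivative f' x) (at x within {0..1})"
    and inf: "(INF x\<in>{0..1} - F. f' x) > 1"
    using lorenz unfolding expanding_lorenz_map_def by (elim conjE exE)
  have sm: "strict_mono_on {0..<c} f" "strict_mono_on {c<..1} f"
    using lorenz by (auto simp: expanding_lorenz_map_def)
  have at: "(f has_real_derivative f' x) (at x)" if "x \<in> {0<..<1} - F" for x
    using bspec[OF f', of x] that by (simp add: at_within_Icc_at)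
  have nonneg: "0 \<le> f' x" if x: "x \<in> {0<..<1} - F" "x \<noteq> c" for x
  proof (cases "x < c")
    case True
    show ?thesis
    proof (rule mono_on_imp_deriv_nonneg[OF _ at[OF x(1)]])
      show "mono_on {0<..<c} f"
        using sm(1) by (intro mono_onI) (force simp: strict_mono_on_def le_less)
    qed (use x True in \<open>auto simp: interior_open\<close>)
  next
    case False
    show ?thesis
    proof (rule mono_on_imp_deriv_nonneg[OF _ at[OF x(1)]])
      show "mono_on {c<..<1} f"
        using sm(2) by (intro mono_onI) (force simp: strict_mono_on_def le_less)
    qed (use x False in \<open>auto simp: interior_open\<close>)
  qed
  \<comment> \<open>A lower bound of the derivatives is needed: \<open>Inf\<close> of an unbounded set is junk.\<close>
  have "f' x \<in> {0..} \<union> {f' 0, f' 1, f' c}" if "x \<in> {0..1} - F" for x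
    using nonneg[of x] that by (cases "x = 0 \<or> x = 1 \<or> x = c") auto
  then have "f' ` ({0..1} - F) \<subseteq> {0..} \<union> {f' 0, f' 1, f' c}"
    by (rule image_subsetI)
  then have "bdd_below (f' ` ({0..1} - F))"
    by (rule bdd_below_mono[rotated]) simp
  then have lower: "(INF x\<in>{0..1} - F. f' x) \<le> f' x" if "x \<in> {0..1} - F" for x
    using that by (rule cINF_lower)
  have "\<exists>D\<ge>INF x\<in>{0..1} - F. f' x. (f has_real_derivative D) (at x)"
    if "x \<in> {0<..<1} - insert c F" for x
    using that at[of x] lower[of x] by auto
  then show ?thesis
    using inf F
    by (intro exI[of _ "INF x\<in>{0..1} - F. f' x"] conjI exI[of _ "insert c F"]) auto
qed

text \<open>If \<open>y \<le> c\<close> then \<open>gR x = gL x\<close>; otherwise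
  \<open>gL y = gR y\<close>. Either way a single continuous branch is involved and
  \<open>slope_ge\<close> applies.\<close>

lemma expansion:
  "\<exists>m>1. (\<forall>x y. 0 \<le> x \<and> x < y \<and> y \<le> 1 \<and> (y \<le> c \<or> c \<le> x) \<longrightarrow> m * (y - x) \<le> gL y - gR x)"
proof -
  obtain m S where m: "m > 1" and S: "finite S" "c \<in> S"
    and D: "\<And>x. x \<in> {0<..<1} - S \<Longrightarrow> \<exists>D\<ge>m. (f has_real_derivative D) (at x)"
    using derivative_bound by metis
  have upd: "(f(c := w) has_real_derivative D) (at x)"
    if "(f has_real_derivative D) (at x)" "x \<noteq> c" for D x w
    by (rule has_field_derivative_transform_within_open[OF that(1), of "- {c}"]) (use that(2) in auto)
  have "m * (y - x) \<le> gL y - gR x" if xy: "0 \<le> x" "x < y" "y \<le> 1" "y \<le> c \<or> c \<le> x" for x y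
  proof (cases "y \<le> c")
    case True
    have "m * (y - x) \<le> gL y - gL x"
    proof (rule slope_ge[OF S(1)])
      show "continuous_on {x..y} gL"
        using xy True by (intro continuous_on_subset[OF continuous_gL]) auto
      show "\<exists>D\<ge>m. (gL has_real_derivative D) (at z)" if "z \<in> {x<..<y} - S" for z
        using that xy D[of z] upd[of _ z] S(2) unfolding gL_def by fastforce
    qed (use xy in auto)
    then show ?thesis
      using xy True by (simp add: gL_def gR_def)
  next
    case False
    have "m * (y - x) \<le> gR y - gR x"
    proof (rule slope_ge[OF S(1)])
      show "continuous_on {x..y} gR"
        using xy False by (intro continuous_on_subset[OF continuous_gR]) auto
      show "\<exists>D\<ge>m. (gR has_real_derivative D) (at z)" if "z \<in> {x<..<y} - S" for z
        using that xy D[of z] upd[of _ z] S(2) unfolding gR_def by fastforce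
    qed (use xy in auto)
    then show ?thesis
      using xy False by (simp add: gL_def gR_def)
  qed
  then show ?thesis
    using m by blast
qed

text \<open>Away from \<open>c\<close> and the end points, \<open>f\<close> preserves being doubled;
  at 0 the convention in \<open>doubled_map\<close> selects the upper copy. At 1 it selects the
  lower one, hence \<open>x < 1\<close>.\<close>

lemma fhat_up:
  assumes "0 \<le> x" "x < 1"
  shows "fhat (up x) = up (gR x)"
proof (cases "x = c")
  case True
  then show ?thesis
    using c_in_A end_points by (simp add: up_def gR_def)
next
  case False
  then show ?thesis
    using assms end_points doubled_points_image_iff[OF lorenz, of x]
    by (cases "x = 0") (auto simp: up_def gR_def)
qed

lemma fhat_down:
  assumes "0 < x" "x \<le> 1"
  shows "fhat (down x) = down (gL x)"
proof (cases "x = c")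
  case True
  then show ?thesis
    using c_in_A end_points by (simp add: down_def gL_def)
next
  case False
  then show ?thesis
    using assms end_points doubled_points_image_iff[OF lorenz, of x]
    by (cases "x = 1") (auto simp: down_def gL_def)
qed

lemma base_fhat: "p \<in> X \<Longrightarrow> base_point (fhat p) \<in> {gL (base_point p), gR (base_point p)}"
  using c_in_A by (cases p) (auto simp: gL_def gR_def X_iff up_def down_def)

section \<open>Segments of the doubled space and their images\<close>

text \<open>For \<open>0 \<le> x < y \<le> 1\<close> this is the order interval from
  \<open>up x\<close> to \<open>down y\<close> in \<open>X\<close>.\<close>

definition seg :: "real \<Rightarrow> real \<Rightarrow> dpoint set" where
  "seg x y = {p \<in> X. x < base_point p \<and> base_point p < y} \<union> {up x, down y}"

lemma X_cases: "p \<in> X \<Longrightarrow> p = up (base_point p) \<or> p = down (base_point p)"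
  by (simp add: X_iff)

text \<open>Over \<open>y\<close> itself, the lower copy lies in the first segment and the upper
  copy in the second.\<close>

lemma seg_trans: "seg x z \<subseteq> seg x y \<union> seg y z"
proof
  fix p assume "p \<in> seg x z"
  then show "p \<in> seg x y \<union> seg y z"
    using X_cases[of p] by (cases "base_point p" y rule: linorder_cases) (auto simp: seg_def)
qed

lemma seg_mono:
  assumes "0 \<le> x" "x \<le> x'" "x' < y'" "y' \<le> y" "y \<le> 1"
  shows "seg x' y' \<subseteq> seg x y"
proof -
  have "up x' \<in> seg x y" "down y' \<in> seg x y"
    using assms by (cases "x = x'"; cases "y = y'"; auto simp: seg_def up_in_X down_in_X)+
  then show ?thesis
    using assms by (auto simp: seg_def)
qed

lemma seg_0_1: "X \<subseteq> seg 0 1"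
proof
  fix p assume p: "p \<in> X"
  then have "0 \<le> base_point p" "base_point p \<le> 1" "p = up (base_point p) \<or> p = down (base_point p)"
    by (auto simp: X_iff)
  moreover have "up 0 = down 0" "up 1 = down 1"
    using end_points by (auto simp: up_def down_def)
  ultimately show "p \<in> seg 0 1"
    using p unfolding seg_def by (cases "base_point p = 0"; cases "base_point p = 1") auto
qed

text \<open>End points are handled by \<open>fhat_up\<close> and \<open>fhat_down\<close>. Over an
  interior base point, the intermediate value theorem on one branch yields \<open>z\<close>, and one
  of its copies is sent to \<open>q\<close>.\<close>

lemma seg_image:
  assumes "0 \<le> x" "x < y" "y \<le> 1" "y \<le> c \<or> c \<le> x"
  shows "seg (gR x) (gL y) \<subseteq> fhat ` seg x y"
proof
  fix q assume "q \<in> seg (gR x) (gL y)"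
  then consider "q = up (gR x)" | "q = down (gL y)"
    | "q \<in> X" "gR x < base_point q" "base_point q < gL y"
    by (auto simp: seg_def)
  then show "q \<in> fhat ` seg x y"
  proof cases
    case 1
    then show ?thesis
      using fhat_up[of x] assms by (auto simp: seg_def intro!: image_eqI[of _ _ "up x"])
  next
    case 2
    then show ?thesis
      using fhat_down[of y] assms by (auto simp: seg_def intro!: image_eqI[of _ _ "down y"])
  next
    case 3
    let ?t = "base_point q"
    have "\<exists>z. x < z \<and> z < y \<and> f z = ?t"
    proof (cases "y \<le> c")
      case True
      then have "continuous_on {x..y} gL"
        using assms by (intro continuous_on_subset[OF continuous_gL]) auto
      moreover have x: "gL x = gR x"
        using assms True by (simp add: gL_def gR_def)
      ultimately obtain z where z: "x \<le> z" "z \<le> y" "gL z = ?t"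
        using IVT'[of gL x ?t y] 3 assms by auto
      then have "x < z" "z < y"
        using 3 x by (auto simp: le_less)
      then show ?thesis
        using z True by (auto simp: gL_def)
    next
      case False
      then have "continuous_on {x..y} gR"
        using assms by (intro continuous_on_subset[OF continuous_gR]) auto
      moreover have y: "gR y = gL y"
        using assms False by (simp add: gL_def gR_def)
      ultimately obtain z where z: "x \<le> z" "z \<le> y" "gR z = ?t"
        using IVT'[of gR x ?t y] 3 assms by auto
      then have "x < z" "z < y"
        using 3 y by (auto simp: le_less)
      then show ?thesis
        using z assms False by (auto simp: gR_def)
    qed
    then obtain z where z: "x < z" "z < y" "f z = ?t"
      by blast
    then have g: "gL z = ?t" "gR z = ?t"
      using assms by (auto simp: gL_def gR_def)
    have "up z \<in> seg x y" "down z \<in> seg x y"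
      using z assms by (auto simp: seg_def up_in_X down_in_X)
    moreover have "q = fhat (up z) \<or> q = fhat (down z)"
      using fhat_up[of z] fhat_down[of z] g z assms 3(1) by (auto simp: X_iff)
    ultimately show ?thesis
      by blast
  qed
qed

section \<open>Open sets of the doubled space\<close>

lemma openin_base_interval:
  assumes "0 \<le> a" "a \<le> 1" "0 \<le> b" "b \<le> 1"
  shows "openin (doubled_topology f c) {p \<in> X. a < base_point p \<and> base_point p < b}"
proof -
  have "openin (doubled_topology f c) {p \<in> X. up a < p}" "openin (doubled_topology f c) {p \<in> X. p < down b}"
    unfolding doubled_topology_def order_topology_on_def
    using up_in_X[OF assms(1,2)] down_in_X[OF assms(3,4)]
    by (intro topology_generated_by_Basis; blast)+
  moreover have "{p \<in> X. a < base_point p \<and> base_point p < b} = {p \<in> X. up a < p} \<inter> {p \<in> X. p < down b}"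
    by (auto simp: up_less_iff less_down_iff)
  ultimately show ?thesis
    by (simp add: openin_Int)
qed

text \<open>An upper copy is approached only from the right, a lower copy only from the left; an
  undoubled point satisfies both premises. The induction follows the generation of open sets from
  rays.\<close>

lemma open_contains_one_sided:
  assumes "openin (doubled_topology f c) U" "p \<in> U"
  shows "(p = up (base_point p) \<longrightarrow>
      (\<exists>e>0. \<forall>q\<in>X. base_point p < base_point q \<and> base_point q < base_point p + e \<longrightarrow> q \<in> U)) \<and>
    (p = down (base_point p) \<longrightarrow>
      (\<exists>e>0. \<forall>q\<in>X. base_point p - e < base_point q \<and> base_point q < base_point p \<longrightarrow> q \<in> U))"
proof -
  have "generate_topology_on ({X} \<union> {{y \<in> X. y < x} | x. x \<in> X} \<union> {{y \<in> X. x < y} | x. x \<in> X}) U"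
    using assms(1) by (simp add: doubled_topology_def order_topology_on_def openin_topology_generated_by_iff)
  then show ?thesis
    using assms(2)
  proof (induction arbitrary: p)
    case (Int V W)
    let ?b = "base_point p"
    have pV: "p \<in> V" and pW: "p \<in> W"
      using Int.prems by auto
    show ?case
    proof (intro conjI impI)
      assume up: "p = up ?b"
      obtain d e where "d > 0" "\<forall>q\<in>X. ?b < base_point q \<and> base_point q < ?b + d \<longrightarrow> q \<in> V"
        "e > 0" "\<forall>q\<in>X. ?b < base_point q \<and> base_point q < ?b + e \<longrightarrow> q \<in> W"
        using Int.IH(1)[OF pV] Int.IH(2)[OF pW] up by blast
      then show "\<exists>e>0. \<forall>q\<in>X. ?b < base_point q \<and> base_point q < ?b + e \<longrightarrow> q \<in> V \<inter> W"
        by (intro exI[of _ "min d e"]) auto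
    next
      assume down: "p = down ?b"
      obtain d e where "d > 0" "\<forall>q\<in>X. ?b - d < base_point q \<and> base_point q < ?b \<longrightarrow> q \<in> V"
        "e > 0" "\<forall>q\<in>X. ?b - e < base_point q \<and> base_point q < ?b \<longrightarrow> q \<in> W"
        using Int.IH(1)[OF pV] Int.IH(2)[OF pW] down by blast
      then show "\<exists>e>0. \<forall>q\<in>X. ?b - e < base_point q \<and> base_point q < ?b \<longrightarrow> q \<in> V \<inter> W"
        by (intro exI[of _ "min d e"]) auto
    qed
  next
    case (UN K)
    then obtain V where V: "V \<in> K" "p \<in> V"
      by blast
    show ?case
      using UN.IH[OF V] V(1) by (meson UnionI)
  next
    case (Basis V)
    then consider "V = X" | x where "x \<in> X" "V = {y \<in> X. y < x}" | x where "x \<in> X" "V = {y \<in> X. x < y}"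
      by blast
    then show ?case
    proof cases
      case 1
      then show ?thesis
        by (auto intro: exI[of _ 1])
    next
      \<comment> \<open>This ray leaves the left of \<open>p\<close> unrestricted, so radius 1 does;
        on the right the distance of the base points serves, which is positive if \<open>p\<close>
        is an upper copy.\<close>
      case (2 x)
      then have "p < x"
        using Basis by auto
      then have "base_point p \<le> base_point x" "p = up (base_point p) \<longrightarrow> base_point p < base_point x"
        using 2(1) up_less_iff[of x "base_point p"] by (auto simp: less_dpoint_def)
      then show ?thesis
        using 2 by (auto simp: less_dpoint_def intro: exI[of _ "base_point x - base_point p"] exI[of _ 1])
    next
      case (3 x)
      then have "x < p"
        using Basis by auto
      then have "base_point x \<le> base_point p" "p = down (base_point p) \<longrightarrow> base_point x < base_point p"
        using 3(1) less_down_iff[of x "base_point p"] by (auto simp: less_dpoint_def)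
      then show ?thesis
        using 3 by (auto simp: less_dpoint_def intro: exI[of _ "base_point p - base_point x"] exI[of _ 1])
    qed
  qed auto
qed

lemma open_contains_seg:
  assumes "openin (doubled_topology f c) U" "U \<noteq> {}"
  shows "\<exists>x y. 0 \<le> x \<and> x < y \<and> y \<le> 1 \<and> seg x y \<subseteq> U"
proof -
  obtain p where p: "p \<in> U"
    using assms(2) by blast
  then have pX: "p \<in> X"
    using openin_subset[OF assms(1)] by auto
  define b where "b = base_point p"
  have b: "0 \<le> b" "b \<le> 1" "p = up b \<or> p = down b"
    using pX by (auto simp: X_iff b_def)
  have ends: "up 0 = down 0" "up 1 = down 1"
    using end_points by (auto simp: up_def down_def)
  have "\<exists>u v. 0 \<le> u \<and> u < v \<and> v \<le> 1 \<and> (\<forall>q\<in>X. u < base_point q \<and> base_point q < v \<longrightarrow> q \<in> U)"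
  \<comment> \<open>In the remaining case \<open>p\<close> is \<open>down b\<close> with
    \<open>b\<close> positive, so there is room on the left.\<close>
  proof (cases "p = up b \<and> b < 1")
    case True
    then obtain e where "e > 0" "\<forall>q\<in>X. b < base_point q \<and> base_point q < b + e \<longrightarrow> q \<in> U"
      using open_contains_one_sided[OF assms(1) p] unfolding b_def by blast
    then show ?thesis
      using b True by (intro exI[of _ b] exI[of _ "min 1 (b + e)"]) auto
  next
    case False
    have "p = down b" "b \<noteq> 0"
      using b ends False by (metis less_le zero_less_one)+
    then obtain e where "e > 0" "\<forall>q\<in>X. b - e < base_point q \<and> base_point q < b \<longrightarrow> q \<in> U"
      using open_contains_one_sided[OF assms(1) p] unfolding b_def by blast
    then show ?thesis
      using b(1,2) \<open>b \<noteq> 0\<close> by (intro exI[of _ "max 0 (b - e)"] exI[of _ b]) auto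
  qed
  then obtain u v where uv: "0 \<le> u" "u < v" "v \<le> 1"
    and U: "\<And>q. q \<in> X \<Longrightarrow> u < base_point q \<Longrightarrow> base_point q < v \<Longrightarrow> q \<in> U"
    by blast
  \<comment> \<open>Moving the ends strictly inside puts \<open>up x\<close> and
    \<open>down y\<close> into \<open>U\<close> as well.\<close>
  obtain x where x: "u < x" "x < v"
    using dense uv by blast
  obtain y where y: "x < y" "y < v"
    using dense x by blast
  have "seg x y \<subseteq> U"
    using U uv x y by (auto simp: seg_def up_in_X down_in_X)
  then show ?thesis
    using x y uv by (intro exI[of _ x] exI[of _ y]) auto
qed

section \<open>Transitivity and the conclusion\<close>

text \<open>A proper closed \<open>T\<close> misses a nondegenerate interval. By invariance, orbits
  starting over \<open>{a<..<b}\<close> stay over \<open>T\<close> and never enter the open set over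
  that interval, against transitivity.\<close>

lemma invariant_closed_full:
  assumes "transitive_lorenz_map f c"
    and T: "closed T" "T \<subseteq> {0..1}" "a < b" "{a..b} \<subseteq> T" "gL ` T \<subseteq> T" "gR ` T \<subseteq> T"
  shows "T = {0..1}"
proof (rule ccontr)
  let ?I = "\<lambda>u v. {p \<in> X. u < base_point p \<and> base_point p < v}"
  assume "T \<noteq> {0..1}"
  then obtain z where z: "0 \<le> z" "z \<le> 1" "z \<notin> T"
    using T(2) by force
  then obtain e where e: "e > 0" "ball z e \<subseteq> - T"
    using T(1) open_contains_ball[of "- T"] by auto
  define u v where "u = max 0 (z - e)" and "v = min 1 (z + e)"
  have uv: "0 \<le> u" "u < v" "v \<le> 1" "\<And>x. u < x \<Longrightarrow> x < v \<Longrightarrow> x \<notin> T"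
    using z e by (auto simp: u_def v_def subset_eq dist_real_def)
  have nonempty: "?I x y \<noteq> {}" if xy: "0 \<le> x" "x < y" "y \<le> 1" for x y
  proof -
    obtain w where "x < w" "w < y"
      using dense xy by blast
    then have "up w \<in> ?I x y"
      using xy by (simp add: up_in_X)
    then show ?thesis
      by blast
  qed
  have ab: "0 \<le> a" "b \<le> 1"
    using subset_trans[OF T(4,2)] T(3) by auto
  have "openin (doubled_topology f c) (?I a b)" "openin (doubled_topology f c) (?I u v)"
    using ab uv(1-3) T(3) by (auto intro!: openin_base_interval)
  moreover have "?I a b \<noteq> {}" "?I u v \<noteq> {}"
    using nonempty ab uv(1-3) T(3) by blast+
  ultimately obtain n where n: "(fhat ^^ n) ` ?I a b \<inter> ?I u v \<noteq> {}"
    using assms(1) unfolding transitive_lorenz_map_def topologically_transitive_def by meson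
  have "(fhat ^^ n) p \<in> X \<and> base_point ((fhat ^^ n) p) \<in> T" if "p \<in> ?I a b" for p n
  proof (induction n)
    case (Suc n)
    then show ?case
      using base_fhat[of "(fhat ^^ n) p"] doubled_map_in_doubled_space[OF lorenz, of "(fhat ^^ n) p"] T(5,6)
      by auto
  qed (use that T(4) in auto)
  then show False
    using n uv(4) by blast
qed

lemma fhat_strongly_transitive:
  assumes "transitive_lorenz_map f c"
  shows "strongly_transitive (doubled_topology f c) fhat"
  unfolding strongly_transitive_def
proof (intro allI impI)
  fix U assume U: "openin (doubled_topology f c) U \<and> U \<noteq> {}"
  define W where "W k = (\<Union>i\<in>{0..k}. (fhat ^^ i) ` U)" for k :: nat
  \<comment> \<open>One \<open>k\<close> must serve the whole segment, so that \<open>P 0 1\<close>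
    yields a uniform bound; concatenation takes the larger index and an image raises it by
    one.\<close>
  define P where "P x y \<longleftrightarrow> 0 \<le> x \<and> x < y \<and> y \<le> 1 \<and> (\<exists>k. seg x y \<subseteq> W k)" for x y
  have W_mono: "W j \<subseteq> W k" if "j \<le> k" for j k
    using that by (force simp: W_def)
  have W_Suc: "fhat ` W k \<subseteq> W (Suc k)" for k
  proof
    fix q assume "q \<in> fhat ` W k"
    then obtain i p where "i \<le> k" "p \<in> U" "q = (fhat ^^ Suc i) p"
      by (auto simp: W_def)
    then show "q \<in> W (Suc k)"
      unfolding W_def by (intro UN_I[of "Suc i"]) auto
  qed
  obtain m where m: "m > 1"
    and expand: "\<And>x y. \<lbrakk>0 \<le> x; x < y; y \<le> 1; y \<le> c \<or> c \<le> x\<rbrakk> \<Longrightarrow> m * (y - x) \<le> gL y - gR x"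
    using expansion by blast
  have g_range: "0 \<le> gR x" "gL x \<le> 1" if "0 \<le> x" "x \<le> 1" for x
    using f_range[OF that] by (auto simp: gL_def gR_def)
  interpret expanding_pair c m gL gR P
  proof
    fix x y z assume "P x y" "P y z"
    then obtain j k where jk: "seg x y \<subseteq> W j" "seg y z \<subseteq> W k" and xyz: "0 \<le> x" "x < y" "y < z" "z \<le> 1"
      by (auto simp: P_def)
    have "seg x z \<subseteq> W (max j k)"
      using seg_trans[of x z y] jk W_mono[OF max.cobounded1, of j k] W_mono[OF max.cobounded2, of k j]
      by blast
    then show "P x z"
      using xyz by (auto simp: P_def)
  next
    fix x y x' y' assume "P x y" "x \<le> x'" "x' < y'" "y' \<le> y"
    then show "P x' y'"
      unfolding P_def using seg_mono[of x x' y' y] by fastforce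
  next
    fix x y assume P: "P x y" and side: "y \<le> c \<or> c \<le> x"
    then obtain k where xy: "0 \<le> x" "x < y" "y \<le> 1" and k: "seg x y \<subseteq> W k"
      by (auto simp: P_def)
    have "0 < m * (y - x)"
      using m xy by simp
    then have "gR x < gL y"
      using expand[OF xy side] by linarith
    moreover have "seg (gR x) (gL y) \<subseteq> W (Suc k)"
      using seg_image[OF xy side] k W_Suc[of k] by blast
    ultimately show "P (gR x) (gL y)"
      using g_range[of x] g_range[of y] xy unfolding P_def by auto
  qed (use m expand in \<open>auto simp: P_def gL_def gR_def\<close>)
  obtain x y where xy: "0 \<le> x" "x < y" "y \<le> 1" "seg x y \<subseteq> U"
    using open_contains_seg U by blast
  moreover have "U \<subseteq> W 0"
    by (simp add: W_def)
  ultimately have "P x y"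
    unfolding P_def by blast
  then have "P 0 1"
    using invariant_closed_full[OF assms] by (rule full_interval)
  then obtain k where "X \<subseteq> W k"
    using seg_0_1 unfolding P_def by blast
  moreover have "(fhat ^^ i) p \<in> X" if "p \<in> U" for i p
    using that U openin_subset[of "doubled_topology f c" U]
    by (induction i) (auto intro: doubled_map_in_doubled_space[OF lorenz])
  then have "W k \<subseteq> X"
    by (auto simp: W_def)
  ultimately show "\<exists>k. (\<Union>i\<in>{0..k}. (fhat ^^ i) ` U) = topspace (doubled_topology f c)"
    unfolding W_def by auto
qed

end

theorem theorem4p12:
  fixes f :: "real \<Rightarrow> real" and c :: real
  assumes "expanding_lorenz_map f c"
    and "transitive_lorenz_map f c"
  shows "strongly_transitive (doubled_topology f c) (doubled_map f c)"
  using assms by (intro lorenz.fhat_strongly_transitive lorenz.intro)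

end
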